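(* For all zonoids $A,B_1,B_2$ in $\mathbb{R}^3$, $$|A|\,|A+B_1+B_2|\le|A+B_1|\,|A+B_2|.$$
   Context: A zonotope is a finite Minkowski sum of segments; a zonoid is a limit of zonotopes in the Hausdorff metric. $|\cdot|$ is 3-dimensional volume and $+$ is Minkowski sum. *)

theory Defs
  imports "HOL-Analysis.Analysis"
begin

text \<open>
  The sum of sets is the Minkowski sum of \<^theory>\<open>HOL-Library.Set_Algebras\<close>. Segments may be
  degenerate, and the empty sum is \<open>{0}\<close>.
\<close>

definition zonotope :: "'a::euclidean_space set \<Rightarrow> bool" where
  "zonotope Z \<longleftrightarrow> (\<exists>(n::nat) a b. Z = (\<Sum>i<n. closed_segment (a i) (b i)))"

text \<open>
  The following value is meaningful only for nonempty bounded sets, and it is a metric only on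
  the nonempty compact ones; so limits are taken among the latter.
\<close>

definition hausdorff_dist :: "'a::metric_space set \<Rightarrow> 'a set \<Rightarrow> real" where
  "hausdorff_dist S T = max (SUP x\<in>S. infdist x T) (SUP y\<in>T. infdist y S)"

definition zonoid :: "'a::euclidean_space set \<Rightarrow> bool" where
  "zonoid K \<longleftrightarrow> K \<noteq> {} \<and> compact K \<and>
     (\<exists>Z. (\<forall>n::nat. zonotope (Z n)) \<and> (\<lambda>n. hausdorff_dist (Z n) K) \<longlonglongrightarrow> 0)"

end

theory Submission
  imports Defs
begin

text \<open>
  For zonotopes \<open>A\<close> and segments \<open>s\<close>, \<open>t\<close> (the general case follows by adding segments one at a
  time and then by approximation), the volume formula \<open>|A| = 1/6 \<Sum> |det(u\<^sub>i, u\<^sub>j, u\<^sub>k)|\<close> for the sum of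
  the segments \<open>[0, u\<^sub>i]\<close> turns the claim into
  \<open>2 \<Sum> |det(s, t, u\<^sub>i)| \<Sum> |det(u\<^sub>i, u\<^sub>j, u\<^sub>k)| \<le> 3 \<Sum> |det(s, u\<^sub>i, u\<^sub>j)| \<Sum> |det(t, u\<^sub>i, u\<^sub>j)|\<close>.
  In coordinates with \<open>s = e\<^sub>1\<close>, \<open>t = e\<^sub>2\<close> and after rescaling the \<open>u\<^sub>i\<close> to third coordinate 1, this
  compares the mean area of a random triangle with the mean distances of its \<open>x\<close>- and of its
  \<open>y\<close>-coordinates. Writing both coordinates as superpositions of indicators of chains reduces it
  to four weights \<open>p, q, r, s\<close> at the corners of a square, where the difference of the two sides is
  a multiple of \<open>(ps - qr)\<^sup>2\<close>.
\<close>

section \<open>Adding a segment to a convex body\<close>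

lemma closed_segment_0_Pair: "closed_segment 0 (c::real, 0::'b::real_vector) = closed_segment 0 c \<times> {0}"
  by (auto simp: closed_segment_def image_iff)

lemma compact_set_plus:
  fixes S T :: "'a::real_normed_vector set"
  assumes "compact S" "compact T"
  shows "compact (S + T)"
proof -
  have "S + T = (\<Union>x\<in>S. \<Union>y\<in>T. {x + y})" by (auto simp: set_plus_def)
  then show ?thesis using compact_sums'[OF assms] by simp
qed

lemma image_set_plus_linear: assumes "linear f" shows "f ` (S + T) = f ` S + f ` T"
proof -
  have "f ` (S + T) = {f (a + b) |a b. a \<in> S \<and> b \<in> T}" by (auto simp: set_plus_def)
  also have "\<dots> = f ` S + f ` T" by (auto simp: set_plus_def linear_add[OF assms])
  finally show ?thesis .
qed

lemma convex_slice_interval: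
  fixes K :: "(real \<times> 'b::euclidean_space) set"
  assumes "convex K" "compact K" "y \<in> snd ` K"
  obtains l u where "l \<le> u" "(\<lambda>x. (x,y)) -` K = {l..u}"
proof -
  let ?S = "(\<lambda>x. (x,y)) -` K"
  have S: "?S = fst ` (K \<inter> (UNIV \<times> {y}))" by force
  have "compact ?S" unfolding S
    by (intro compact_continuous_image compact_Int_closed assms continuous_intros closed_Times)
  moreover have "convex ?S" unfolding S
    by (intro convex_linear_image linear_fst convex_Int assms convex_Times convex_UNIV convex_singleton)
  then have "connected ?S" by (simp add: convex_connected)
  ultimately obtain l u where lu: "?S = {l..u}"
    using connected_compact_interval_1[of ?S] by auto
  moreover have "?S \<noteq> {}" using assms(3) by auto
  ultimately have "l \<le> u" by simp
  from that[OF this lu] show ?thesis .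
qed

lemma emeasure_lborel_plus_segment:
  fixes K :: "(real \<times> 'b::euclidean_space) set"
  assumes "convex K" "compact K" "c \<ge> 0"
  shows "emeasure lborel (K + closed_segment 0 (c, 0))
       = emeasure lborel K + ennreal c * emeasure lborel (snd ` K)"
proof -
  have cK': "compact (K + closed_segment 0 (c, 0))"
    by (intro compact_set_plus assms) auto
  have cs: "compact (snd ` K)"
    by (intro compact_continuous_image assms continuous_intros)
  have Fub: "emeasure lborel S = (\<integral>\<^sup>+y. emeasure lborel ((\<lambda>x. (x, y)) -` S) \<partial>lborel)"
    if "compact S" for S :: "(real \<times> 'b) set"
  proof -
    have "S \<in> sets (lborel \<Otimes>\<^sub>M (lborel :: 'b measure))"
      using that by (subst lborel_prod) (simp add: borel_compact)
    from lborel_pair.emeasure_pair_measure_alt2[OF this] show ?thesis by (simp add: lborel_prod)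
  qed
  have sl: "emeasure lborel ((\<lambda>x. (x, y)) -` (K + closed_segment 0 (c, 0)))
     = emeasure lborel ((\<lambda>x. (x, y)) -` K) + ennreal c * indicator (snd ` K) y" for y
  proof (cases "y \<in> snd ` K")
    case True
    then obtain l u where lu: "l \<le> u" "(\<lambda>x. (x,y)) -` K = {l..u}"
      using convex_slice_interval assms by metis
    have "(\<lambda>x. (x, y)) -` (K + closed_segment 0 (c, 0)) = (\<lambda>x. (x,y)) -` K + {0..c}"
      using \<open>c \<ge> 0\<close> by (force simp: set_plus_def closed_segment_0_Pair closed_segment_eq_real_ivl)
    also have "\<dots> = {l..u + c}"
    proof -
      \<comment> \<open>Cutting \<open>x\<close> off at \<open>u\<close> leaves a remainder that is
        0 or \<open>x - u\<close>, hence at most \<open>c\<close>.\<close>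
      have "x \<in> {l..u} + {0..c}" if "x \<in> {l..u + c}" for x
        using that lu assms
        by (intro set_plus_intro[of "min x u" _ "x - min x u", simplified]) (auto simp: min_def)
      then show ?thesis by (auto simp: set_plus_def lu)
    qed
    finally show ?thesis using True lu assms by (simp flip: ennreal_plus)
  next
    case False
    then have "(\<lambda>x. (x, y)) -` (K + closed_segment 0 (c, 0)) = {}" "(\<lambda>x. (x, y)) -` K = {}"
      by (force simp: set_plus_def closed_segment_0_Pair)+
    with False show ?thesis by simp
  qed
  have "emeasure lborel (K + closed_segment 0 (c, 0))
      = (\<integral>\<^sup>+y. emeasure lborel ((\<lambda>x. (x, y)) -` K) + ennreal c * indicator (snd ` K) y \<partial>lborel)"
    by (simp add: Fub[OF cK'] sl)
  also have "\<dots> = (\<integral>\<^sup>+y. emeasure lborel ((\<lambda>x. (x, y)) -` K) \<partial>lborel)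
      + (\<integral>\<^sup>+y. ennreal c * indicator (snd ` K) y \<partial>lborel)"
  proof (rule nn_integral_add)
    have "K \<in> sets (lborel \<Otimes>\<^sub>M (lborel :: 'b measure))"
      using assms by (subst lborel_prod) (simp add: borel_compact)
    from lborel_pair.measurable_emeasure_Pair2[OF this]
    show "(\<lambda>y. emeasure lborel ((\<lambda>x. (x, y)) -` K)) \<in> borel_measurable lborel" by simp
    have [measurable]: "snd ` K \<in> sets borel" using cs by (simp add: borel_compact)
    show "(\<lambda>y. ennreal c * indicator (snd ` K) y) \<in> borel_measurable lborel" by simp
  qed
  also have "\<dots> = emeasure lborel K + ennreal c * emeasure lborel (snd ` K)"
    using cs by (simp add: Fub[OF \<open>compact K\<close>] nn_integral_cmult_indicator borel_compact)
  finally show ?thesis .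
qed

section \<open>Real-valued volume and transfer to coordinate spaces\<close>

lemma measure_lebesgue_eq_lborel_compact:
  "compact S \<Longrightarrow> measure lebesgue S = measure lborel S"
  by (simp add: borel_compact)

lemma emeasure_lborel_compact: "compact S \<Longrightarrow> emeasure lborel S = ennreal (measure lborel S)"
  using emeasure_compact_finite[of S] by (simp add: emeasure_eq_ennreal_measure)

lemma measure_plus_segment:
  fixes K :: "(real \<times> 'b::euclidean_space) set"
  assumes "convex K" "compact K" "c \<ge> 0"
  shows "measure lborel (K + closed_segment 0 (c, 0))
       = measure lborel K + c * measure lborel (snd ` K)"
proof -
  have "compact (K + closed_segment 0 (c, 0))" "compact (snd ` K)"
    by (intro compact_set_plus compact_continuous_image assms continuous_intros; simp)+
  then show ?thesis
    using emeasure_lborel_plus_segment[OF assms] assms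
    by (simp add: emeasure_lborel_compact flip: ennreal_plus ennreal_mult)
qed

text \<open>Lebesgue measure is determined by its values on boxes, so its image under
  \<open>h\<close> is again Lebesgue measure once preimages of boxes have the right volume.\<close>

lemma measure_lborel_vec:
  fixes h :: "'a::euclidean_space \<Rightarrow> real^'n"
  assumes [measurable]: "h \<in> borel_measurable borel"
    and box: "\<And>l u. (\<And>i. l$i \<le> u$i) \<Longrightarrow> emeasure lborel (h -` box l u) = ennreal (\<Prod>i\<in>UNIV. u$i - l$i)"
    and S: "S \<in> sets borel"
  shows "measure lborel S = measure lborel (h -` S)"
proof -
  have "lborel = distr lborel borel h"
  proof (rule lborel_eqI)
    fix l u :: "real^'n"
    assume "\<And>b. b \<in> Basis \<Longrightarrow> l \<bullet> b \<le> u \<bullet> b"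
    then have "l$i \<le> u$i" for i
      by (metis axis_in_Basis_iff cart_eq_inner_axis real_inner_1_right inner_real_def Basis_real_def insertI1)
    moreover have "(\<Prod>b\<in>Basis. (u - l) \<bullet> b) = (\<Prod>i\<in>UNIV. u$i - l$i)"
      by (simp add: Basis_vec_def UNION_singleton_eq_range prod.reindex inj_on_def axis_eq_axis inner_axis)
    ultimately show "emeasure (distr lborel borel h) (box l u) = ennreal (\<Prod>b\<in>Basis. (u - l) \<bullet> b)"
      by (simp add: emeasure_distr box)
  qed simp
  then have "measure lborel S = measure (distr lborel borel h) S" by simp
  also have "\<dots> = measure lborel (h -` S)" using S by (simp add: measure_distr)
  finally show ?thesis .
qed

text \<open>The map \<open>h\<close> identifies the product, where Fubini is available, with
  \<open>real^'n\<close>; the segment direction \<open>h (1, 0)\<close> is the factor split off.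
  Both the planar and the spatial case are instances.\<close>

lemma measure_plus_segment_vec:
  fixes h :: "real \<times> 'b::euclidean_space \<Rightarrow> real^'n"
  assumes h: "linear h" and g: "linear g" and gh: "\<And>p. g (h p) = p" and hg: "\<And>x. h (g x) = x"
    and box: "\<And>l u. (\<And>i. l$i \<le> u$i) \<Longrightarrow> emeasure lborel (h -` box l u) = ennreal (\<Prod>i\<in>UNIV. u$i - l$i)"
    and K: "convex K" "compact K" and "c \<ge> 0"
  shows "measure lborel (K + closed_segment 0 (c *\<^sub>R h (1, 0)))
       = measure lborel K + c * measure lborel ((\<lambda>x. snd (g x)) ` K)"
proof -
  have m: "measure lborel S = measure lborel (g ` S)" if "compact S" for S
  proof -
    have "h -` S = g ` S" using hg by (auto simp: image_iff intro: gh[symmetric])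
    moreover have "h \<in> borel_measurable borel"
      using h by (simp add: borel_measurable_continuous_onI linear_continuous_on linear_conv_bounded_linear)
    ultimately show ?thesis using measure_lborel_vec[OF _ box, of S] that by (simp add: borel_compact)
  qed
  have "g (c *\<^sub>R h (1, 0)) = (c, 0)"
    by (simp add: linear_cmul[OF g] gh)
  then have "closed_segment 0 (c, 0) = g ` closed_segment 0 (c *\<^sub>R h (1, 0))"
    by (simp add: linear_0[OF g] flip: closed_segment_linear_image[OF g])
  then have "g ` (K + closed_segment 0 (c *\<^sub>R h (1, 0))) = g ` K + closed_segment 0 (c, 0)"
    by (simp add: image_set_plus_linear[OF g])
  moreover have "convex (g ` K)" "compact (g ` K)"
    using K g by (auto intro!: convex_linear_image compact_continuous_image
        simp: linear_continuous_on linear_conv_bounded_linear)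
  moreover have "snd ` g ` K = (\<lambda>x. snd (g x)) ` K" by (simp add: image_image)
  ultimately show ?thesis
    using measure_plus_segment[of "g ` K" c] m[of K] m[of "K + closed_segment 0 (c *\<^sub>R h (1, 0))"] K \<open>c \<ge> 0\<close>
    by (simp add: compact_set_plus)
qed

lemma measure_plus_segment_2:
  fixes K :: "(real^2) set"
  assumes "convex K" "compact K" "c \<ge> 0"
  shows "measure lborel (K + closed_segment 0 (c *\<^sub>R axis 1 1))
       = measure lborel K + c * measure lborel ((\<lambda>x. x$2) ` K)"
proof -
  let ?h = "\<lambda>p. vector [fst p, snd p] :: real^2" and ?g = "\<lambda>x::real^2. (x$1, x$2)"
  have "measure lborel (K + closed_segment 0 (c *\<^sub>R ?h (1, 0)))
       = measure lborel K + c * measure lborel ((\<lambda>x. snd (?g x)) ` K)"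
  proof (rule measure_plus_segment_vec[OF _ _ _ _ _ assms])
    show "linear ?h" "linear ?g"
      by (auto intro!: linearI simp: vec_eq_iff forall_2)
    fix l u :: "real^2" assume "\<And>i. l$i \<le> u$i"
    moreover have "?h -` box l u = box (l$1) (u$1) \<times> box (l$2) (u$2)"
      by (auto simp: mem_box_cart forall_2)
    ultimately show "emeasure lborel (?h -` box l u) = ennreal (\<Prod>i\<in>UNIV. u$i - l$i)"
      by (simp add: lborel.emeasure_pair_measure_Times ennreal_mult UNIV_2 flip: lborel_prod)
  qed (auto simp: vec_eq_iff forall_2)
  moreover have "vector [1, 0] = (axis 1 1 :: real^2)"
    by (simp add: vec_eq_iff forall_2 axis_def)
  ultimately show ?thesis by simp
qed

lemma measure_plus_segment_3:
  fixes K :: "(real^3) set"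
  assumes "convex K" "compact K" "c \<ge> 0"
  shows "measure lborel (K + closed_segment 0 (c *\<^sub>R axis 1 1))
       = measure lborel K + c * measure lborel ((\<lambda>x. vector [x$2, x$3] :: real^2) ` K)"
proof -
  let ?h = "\<lambda>p :: real \<times> (real^2). vector [fst p, snd p $ 1, snd p $ 2] :: real^3"
  let ?g = "\<lambda>x::real^3. (x$1, vector [x$2, x$3] :: real^2)"
  have "measure lborel (K + closed_segment 0 (c *\<^sub>R ?h (1, 0)))
       = measure lborel K + c * measure lborel ((\<lambda>x. snd (?g x)) ` K)"
  proof (rule measure_plus_segment_vec[OF _ _ _ _ _ assms])
    show "linear ?h" "linear ?g"
      by (auto intro!: linearI simp: vec_eq_iff forall_2 forall_3)
    fix l u :: "real^3" assume lu: "\<And>i. l$i \<le> u$i"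
    let ?l = "vector [l$2, l$3] :: real^2" and ?u = "vector [u$2, u$3] :: real^2"
    have *: "?h -` box l u = box (l$1) (u$1) \<times> box ?l ?u"
      by (auto simp: mem_box_cart forall_2 forall_3)
    have **: "emeasure lborel (box ?l ?u) = ennreal ((u$2 - l$2) * (u$3 - l$3))"
    proof -
      have "\<forall>b\<in>Basis. ?l \<bullet> b \<le> ?u \<bullet> b"
        using lu by (auto simp: Basis_vec_def inner_axis forall_2 UNIV_2)
      then show ?thesis
        by (simp add: emeasure_lborel_box_eq Basis_vec_def UNIV_2 axis_eq_axis inner_axis)
    qed
    show "emeasure lborel (?h -` box l u) = ennreal (\<Prod>i\<in>UNIV. u$i - l$i)"
    proof -
      have "(\<Prod>i\<in>UNIV. u$i - l$i) = (u$1 - l$1) * ((u$2 - l$2) * (u$3 - l$3))"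
        unfolding UNIV_3 by (subst prod.insert, simp, simp)+ simp
      moreover have "emeasure lborel (box (l$1) (u$1) \<times> box ?l ?u)
          = emeasure lborel (box (l$1) (u$1)) * emeasure lborel (box ?l ?u)"
        unfolding lborel_prod[symmetric] by (rule lborel.emeasure_pair_measure_Times) auto
      ultimately show ?thesis
        using lu * ** by (simp add: ennreal_mult)
    qed
  qed (auto simp: vec_eq_iff forall_2 forall_3)
  moreover have "vector [1, 0, 0] = (axis 1 1 :: real^3)"
    by (simp add: vec_eq_iff forall_3 axis_def)
  ultimately show ?thesis by simp
qed

section \<open>The volume of a zonotope\<close>

text \<open>A list lets equal generators count repeatedly and lets segments be added one at a time.
  Starting all segments at 0 loses only a translation, which does not affect volume.\<close>

definition zonotope_of :: "'a::euclidean_space list \<Rightarrow> 'a set" where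
  "zonotope_of us = (\<Sum>u\<leftarrow>us. closed_segment 0 u)"

lemma zonotope_of_Nil [simp]: "zonotope_of [] = {0}"
  by (simp add: zonotope_of_def)

lemma zonotope_of_Cons [simp]: "zonotope_of (u # us) = closed_segment 0 u + zonotope_of us"
  by (simp add: zonotope_of_def)

lemma zonotope_of_append: "zonotope_of (us @ vs) = zonotope_of us + zonotope_of vs"
  by (simp add: zonotope_of_def)

lemma compact_zonotope_of: "compact (zonotope_of us)"
  by (induction us) (auto intro: compact_set_plus)

lemma convex_zonotope_of: "convex (zonotope_of us)"
  by (induction us) (auto intro: convex_set_plus)

lemma linear_image_segment_0:
  "linear f \<Longrightarrow> f ` closed_segment 0 b = closed_segment 0 (f b)"
  by (metis closed_segment_linear_image linear_0)

lemma linear_image_zonotope_of: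
  "linear f \<Longrightarrow> f ` zonotope_of us = zonotope_of (map f us)"
  by (induction us)
    (simp_all add: linear_0 image_set_plus_linear linear_image_segment_0)

lemma Icc_plus_Icc:
  fixes a b c d :: real
  assumes "a \<le> b" "c \<le> d"
  shows "{a..b} + {c..d} = {a + c..b + d}"
proof -
  have "x \<in> {a..b} + {c..d}" if "x \<in> {a + c..b + d}" for x
  proof -
    have "x = max a (x - d) + (x - max a (x - d))" by simp
    moreover have "max a (x - d) \<in> {a..b}" "x - max a (x - d) \<in> {c..d}"
      using that assms by auto
    ultimately show ?thesis by (metis set_plus_intro)
  qed
  then show ?thesis by (auto simp: set_plus_def)
qed

text \<open>Lengths of intervals add under Minkowski sum. The left endpoint does not affect the
  length, so it is left existential.\<close>

lemma zonotope_of_real: "\<exists>l. zonotope_of us = {l..l + (\<Sum>u\<leftarrow>us. \<bar>u\<bar>)}" for us :: "real list"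
proof (induction us)
  case Nil
  then show ?case by auto
next
  case (Cons u us)
  then obtain l where l: "zonotope_of us = {l..l + (\<Sum>u\<leftarrow>us. \<bar>u\<bar>)}" by blast
  have "zonotope_of (u # us) = {min 0 u..max 0 u} + {l..l + (\<Sum>u\<leftarrow>us. \<bar>u\<bar>)}"
    by (simp add: l closed_segment_eq_real_ivl)
  also have "\<dots> = {min 0 u + l..max 0 u + (l + (\<Sum>u\<leftarrow>us. \<bar>u\<bar>))}"
    by (rule Icc_plus_Icc) (auto intro!: sum_list_nonneg)
  also have "max 0 u + (l + (\<Sum>u\<leftarrow>us. \<bar>u\<bar>)) = (min 0 u + l) + (\<Sum>u\<leftarrow>u # us. \<bar>u\<bar>)" by auto
  finally show ?case by blast
qed

lemma measure_zonotope_of_real: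
  "measure lborel (zonotope_of us) = (\<Sum>u\<leftarrow>us. \<bar>u\<bar>)" for us :: "real list"
proof -
  have "0 \<le> (\<Sum>u\<leftarrow>us. \<bar>u\<bar>)" by (auto intro!: sum_list_nonneg)
  then show ?thesis using zonotope_of_real[of us] by auto
qed

section \<open>Determinants and the volume formulas in dimensions 2 and 3\<close>

definition det2 :: "real^2 \<Rightarrow> real^2 \<Rightarrow> real" where
  "det2 u v = u$1 * v$2 - u$2 * v$1"

definition det3 :: "real^3 \<Rightarrow> real^3 \<Rightarrow> real^3 \<Rightarrow> real" where
  "det3 u v w = u$1 * (v$2 * w$3 - v$3 * w$2) - u$2 * (v$1 * w$3 - v$3 * w$1)
    + u$3 * (v$1 * w$2 - v$2 * w$1)"

text \<open>The matrix with rows \<open>f u\<close> and \<open>f v\<close> is the one with rows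
  \<open>u\<close> and \<open>v\<close> times the transpose of \<open>matrix f\<close>, and
  \<open>det\<close> is multiplicative.\<close>

lemma det2_linear:
  assumes "linear f" shows "det2 (f u) (f v) = det (matrix f) * det2 u v"
proof -
  have *: "det2 a b = det (vector [a, b] :: real^2^2)" for a b
    by (simp add: det2_def det_2 algebra_simps)
  have "det2 (f u) (f v) = det (vector [matrix f *v u, matrix f *v v] :: real^2^2)"
    using assms by (simp add: matrix_works *)
  also have "vector [matrix f *v u, matrix f *v v] = (vector [u, v] :: real^2^2) ** transpose (matrix f)"
    by (simp add: vec_eq_iff forall_2 matrix_matrix_mult_def matrix_vector_mult_def transpose_def mult.commute)
  finally show ?thesis by (simp only: det_mul det_transpose * mult.commute)
qed

text \<open>Proved as in the plane. It serves twice: for rotations, where the factor is 1 or -1, and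
  for the change of basis in \<open>det3_inequality\<close>.\<close>

lemma det3_linear:
  assumes "linear f" shows "det3 (f u) (f v) (f w) = det (matrix f) * det3 u v w"
proof -
  have *: "det3 a b c = det (vector [a, b, c] :: real^3^3)" for a b c
    by (simp add: det3_def det_3 algebra_simps)
  have "det3 (f u) (f v) (f w) = det (vector [matrix f *v u, matrix f *v v, matrix f *v w] :: real^3^3)"
    using assms by (simp add: matrix_works *)
  also have "vector [matrix f *v u, matrix f *v v, matrix f *v w]
      = (vector [u, v, w] :: real^3^3) ** transpose (matrix f)"
    by (simp add: vec_eq_iff forall_3 matrix_matrix_mult_def matrix_vector_mult_def transpose_def mult.commute)
  finally show ?thesis by (simp only: det_mul det_transpose * mult.commute)
qed

lemma orthogonal_transformation_to_axis:
  fixes s :: "real^'n"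
  obtains f :: "real^'n \<Rightarrow> real^'n" where "orthogonal_transformation f" "f s = norm s *\<^sub>R axis k 1"
  by (rule orthogonal_transformation_exists[of s "norm s *\<^sub>R axis k 1"]) auto

text \<open>After \<open>s\<close> is rotated onto the first axis, the new segment adds
  \<open>norm s\<close> times the length of the projection of the zonotope onto the second axis.
  That projection is a one-dimensional zonotope.\<close>

lemma measure_zonotope_of_Cons_2:
  fixes us :: "(real^2) list"
  shows "measure lborel (zonotope_of (s # us))
     = measure lborel (zonotope_of us) + (\<Sum>u\<leftarrow>us. \<bar>det2 s u\<bar>)"
proof -
  obtain f :: "real^2 \<Rightarrow> real^2" where f: "orthogonal_transformation f" "f s = norm s *\<^sub>R axis 1 1"
    by (rule orthogonal_transformation_to_axis[of s 1])
  have lf: "linear f" using f by (simp add: orthogonal_transformation_linear)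
  have m: "measure lborel (zonotope_of vs) = measure lborel (zonotope_of (map f vs))" for vs
    using measure_orthogonal_image[OF f(1), of "zonotope_of vs"] compact_zonotope_of[of vs]
      compact_zonotope_of[of "map f vs"]
    by (simp add: measure_lebesgue_eq_lborel_compact linear_image_zonotope_of[OF lf] lmeasurable_compact)
  have d: "norm s * \<bar>f u $ 2\<bar> = \<bar>det2 s u\<bar>" for u
  proof -
    have "norm s * f u $ 2 = det2 (f s) (f u)" by (simp add: f det2_def axis_def)
    then have "\<bar>norm s * f u $ 2\<bar> = \<bar>det2 s u\<bar>" using orthogonal_transformation_det[OF f(1)]
      by (simp add: det2_linear[OF lf] abs_mult)
    then show ?thesis by (simp add: abs_mult)
  qed
  have l2: "linear (\<lambda>x::real^2. x $ 2)" by (auto intro!: linearI)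
  have "measure lborel (zonotope_of (s # us))
      = measure lborel (zonotope_of (map f us) + closed_segment 0 (norm s *\<^sub>R axis 1 1))"
    by (subst m) (simp add: f add.commute)
  also have "\<dots> = measure lborel (zonotope_of us) + norm s * (\<Sum>u\<leftarrow>us. \<bar>f u $ 2\<bar>)"
    by (simp add: measure_plus_segment_2 convex_zonotope_of compact_zonotope_of m[of us]
        linear_image_zonotope_of[OF l2] measure_zonotope_of_real o_def)
  also have "norm s * (\<Sum>u\<leftarrow>us. \<bar>f u $ 2\<bar>) = (\<Sum>u\<leftarrow>us. \<bar>det2 s u\<bar>)"
    by (simp add: d flip: sum_list_const_mult)
  finally show ?thesis .
qed

text \<open>A new generator \<open>s\<close> enters the double sum in either position, and the pair
  of \<open>s\<close> with itself contributes nothing; hence the factor 2.\<close>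

lemma measure_zonotope_of_2:
  fixes us :: "(real^2) list"
  shows "2 * measure lborel (zonotope_of us) = (\<Sum>u\<leftarrow>us. \<Sum>v\<leftarrow>us. \<bar>det2 u v\<bar>)"
proof (induction us)
  case (Cons s us)
  have "det2 s s = 0" "\<And>u. \<bar>det2 u s\<bar> = \<bar>det2 s u\<bar>" by (auto simp: det2_def algebra_simps)
  with Cons show ?case
    unfolding measure_zonotope_of_Cons_2 by (simp add: sum_list_addf)
qed simp

text \<open>As in the plane, but the projection along \<open>s\<close> is now a planar zonotope,
  whose doubled area is given by \<open>measure_zonotope_of_2\<close>.\<close>

lemma measure_zonotope_of_Cons_3:
  fixes us :: "(real^3) list"
  shows "2 * measure lborel (zonotope_of (s # us))
     = 2 * measure lborel (zonotope_of us) + (\<Sum>u\<leftarrow>us. \<Sum>v\<leftarrow>us. \<bar>det3 s u v\<bar>)"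
proof -
  obtain f :: "real^3 \<Rightarrow> real^3" where f: "orthogonal_transformation f" "f s = norm s *\<^sub>R axis 1 1"
    by (rule orthogonal_transformation_to_axis[of s 1])
  have lf: "linear f" using f by (simp add: orthogonal_transformation_linear)
  let ?p = "\<lambda>x::real^3. vector [x$2, x$3] :: real^2"
  have m: "measure lborel (zonotope_of vs) = measure lborel (zonotope_of (map f vs))" for vs
    using measure_orthogonal_image[OF f(1), of "zonotope_of vs"] compact_zonotope_of[of vs]
      compact_zonotope_of[of "map f vs"]
    by (simp add: measure_lebesgue_eq_lborel_compact linear_image_zonotope_of[OF lf] lmeasurable_compact)
  have d: "norm s * \<bar>det2 (?p (f u)) (?p (f v))\<bar> = \<bar>det3 s u v\<bar>" for u v
  proof -
    have "norm s * det2 (?p (f u)) (?p (f v)) = det3 (f s) (f u) (f v)"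
      by (simp add: f det2_def det3_def axis_def algebra_simps)
    then have "\<bar>norm s * det2 (?p (f u)) (?p (f v))\<bar> = \<bar>det3 s u v\<bar>"
      using orthogonal_transformation_det[OF f(1)]
      by (simp add: det3_linear[OF lf] abs_mult)
    then show ?thesis by (simp add: abs_mult)
  qed
  have l2: "linear ?p" by (auto intro!: linearI simp: vec_eq_iff forall_2)
  have "2 * measure lborel (zonotope_of (s # us))
      = 2 * measure lborel (zonotope_of (map f us) + closed_segment 0 (norm s *\<^sub>R axis 1 1))"
    by (subst m) (simp add: f add.commute)
  also have "\<dots> = 2 * measure lborel (zonotope_of us)
      + norm s * (2 * measure lborel (zonotope_of (map (\<lambda>u. ?p (f u)) us)))"
    by (simp add: measure_plus_segment_3 convex_zonotope_of compact_zonotope_of m[of us]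
        linear_image_zonotope_of[OF l2] o_def)
  also have "norm s * (2 * measure lborel (zonotope_of (map (\<lambda>u. ?p (f u)) us)))
      = (\<Sum>u\<leftarrow>us. \<Sum>v\<leftarrow>us. \<bar>det3 s u v\<bar>)"
    unfolding measure_zonotope_of_2 by (simp add: d o_def flip: sum_list_const_mult)
  finally show ?thesis .
qed

text \<open>A new generator can stand in three positions of a triple and triples repeating it
  vanish, so the triple sum grows by 3 times the double sum of
  \<open>measure_zonotope_of_Cons_3\<close>.\<close>

lemma measure_zonotope_of_3:
  fixes us :: "(real^3) list"
  shows "6 * measure lborel (zonotope_of us) = (\<Sum>u\<leftarrow>us. \<Sum>v\<leftarrow>us. \<Sum>w\<leftarrow>us. \<bar>det3 u v w\<bar>)"
proof (induction us)
  case (Cons s us)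
  have "det3 s s u = 0" "det3 s u s = 0" "det3 u s s = 0" "\<bar>det3 u s v\<bar> = \<bar>det3 s u v\<bar>"
    "\<bar>det3 u v s\<bar> = \<bar>det3 s u v\<bar>" for u v
  proof -
    have "det3 u s v = - det3 s u v" "det3 u v s = det3 s u v" by (simp_all add: det3_def algebra_simps)
    then show "\<bar>det3 u s v\<bar> = \<bar>det3 s u v\<bar>" "\<bar>det3 u v s\<bar> = \<bar>det3 s u v\<bar>" by simp_all
  qed (simp_all add: det3_def algebra_simps)
  with Cons measure_zonotope_of_Cons_3[of s us] show ?case
    by (simp add: sum_list_addf sum_list_const_mult del: zonotope_of_Cons)
qed simp

section \<open>An inequality for random triangles\<close>

text \<open>
  A function with finitely many values is, up to a constant, a nonnegative combination of
  indicators of a chain of sets. A seminorm is subadditive on such a combination, whereas the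
  weighted sum of the differences on the right is additive, because the indicators are comonotone.
\<close>

lemma layer_cake_bound:
  fixes \<Phi> :: "('i \<Rightarrow> real) \<Rightarrow> real" and m :: "'i \<Rightarrow> 'i \<Rightarrow> real"
  assumes "finite I"
    and cong: "\<And>f g. (\<And>i. i \<in> I \<Longrightarrow> f i = g i) \<Longrightarrow> \<Phi> f = \<Phi> g"
    and sub: "\<And>f g. \<Phi> (\<lambda>i. f i + g i) \<le> \<Phi> f + \<Phi> g"
    and hom: "\<And>c f. 0 \<le> c \<Longrightarrow> \<Phi> (\<lambda>i. c * f i) \<le> c * \<Phi> f"
    and const: "\<And>c. \<Phi> (\<lambda>i. c) \<le> 0"
    and ind: "\<And>S. S \<subseteq> I \<Longrightarrow>
      \<Phi> (indicator S) \<le> (\<Sum>k\<in>I. \<Sum>l\<in>I. m k l * \<bar>indicator S k - indicator S l\<bar>)"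
  shows "\<Phi> x \<le> (\<Sum>k\<in>I. \<Sum>l\<in>I. m k l * \<bar>x k - x l\<bar>)"
proof (induction "card (x ` I)" arbitrary: x rule: less_induct)
  case less
  show ?case
  proof (cases "\<exists>c. \<forall>i\<in>I. x i = c")
    case True
    then obtain c where c: "\<And>i. i \<in> I \<Longrightarrow> x i = c" by blast
    have "\<Phi> x = \<Phi> (\<lambda>i. c)" by (rule cong) (simp add: c)
    also have "\<dots> \<le> 0" by (rule const)
    also have "0 = (\<Sum>k\<in>I. \<Sum>l\<in>I. m k l * \<bar>x k - x l\<bar>)" by (simp add: c)
    finally show ?thesis .
  next
    case False
    \<comment> \<open>Peel off the top layer: \<open>M\<close> and \<open>N\<close> are the two
      largest values of \<open>x\<close>, and \<open>y\<close> lowers the top level set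
      \<open>S\<close> from \<open>M\<close> to \<open>N\<close>. Then \<open>y\<close> has fewer
      values, and \<open>x\<close> is \<open>y\<close> plus \<open>M - N\<close> times the indicator
      of \<open>S\<close>.\<close>
    define M where "M = Max (x ` I)"
    define N where "N = Max (x ` I - {M})"
    define S where "S = {i\<in>I. x i = M}"
    define y where "y = (\<lambda>i. if i \<in> S then N else x i)"
    have "I \<noteq> {}" using False by auto
    then have M: "M \<in> x ` I" "\<And>i. i \<in> I \<Longrightarrow> x i \<le> M"
      using \<open>finite I\<close> by (simp_all add: M_def)
    have "x ` I - {M} \<noteq> {}" using False by blast
    then have "N \<in> x ` I - {M}" unfolding N_def
      using \<open>finite I\<close> by (intro Max_in) auto
    moreover have N: "x i \<le> N" if "i \<in> I" "i \<notin> S" for i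
      using that \<open>finite I\<close> unfolding N_def by (intro Max_ge) (auto simp: S_def)
    ultimately have "N < M" using M(2) by fastforce
    have "y ` I \<subseteq> x ` I - {M}"
      using \<open>N \<in> x ` I - {M}\<close> by (auto simp: y_def S_def)
    then have "card (y ` I) < card (x ` I)"
      using M(1) \<open>finite I\<close> by (intro psubset_card_mono) auto
    then have IH: "\<Phi> y \<le> (\<Sum>k\<in>I. \<Sum>l\<in>I. m k l * \<bar>y k - y l\<bar>)" by (rule less)
    have "\<Phi> x = \<Phi> (\<lambda>i. y i + (M - N) * indicator S i)"
      by (rule cong) (auto simp: y_def S_def)
    also have "\<dots> \<le> \<Phi> y + \<Phi> (\<lambda>i. (M - N) * indicator S i)" by (rule sub)
    also have "\<dots> \<le> \<Phi> y + (M - N) * \<Phi> (indicator S)"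
      using hom[of "M - N" "indicator S"] \<open>N < M\<close> by simp
    also have "\<dots> \<le> (\<Sum>k\<in>I. \<Sum>l\<in>I. m k l * \<bar>y k - y l\<bar>)
        + (M - N) * (\<Sum>k\<in>I. \<Sum>l\<in>I. m k l * \<bar>indicator S k - indicator S l\<bar>)"
      using \<open>N < M\<close> by (intro add_mono IH mult_left_mono ind) (auto simp: S_def)
    also have "\<dots> = (\<Sum>k\<in>I. \<Sum>l\<in>I. m k l * (\<bar>y k - y l\<bar> + (M - N) * \<bar>indicator S k - indicator S l\<bar>))"
      by (simp add: sum_distrib_left sum.distrib distrib_left mult.left_commute)
    \<comment> \<open>Comonotonicity: off \<open>S\<close> the value of \<open>y\<close> is at most
      \<open>N\<close>, its value on \<open>S\<close>, so the differences of \<open>y\<close> and of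
      the indicator never have opposite signs and their absolute values add.\<close>
    also have "\<dots> = (\<Sum>k\<in>I. \<Sum>l\<in>I. m k l * \<bar>x k - x l\<bar>)"
    proof (intro sum.cong refl)
      fix k l assume "k \<in> I" "l \<in> I"
      then have "\<bar>y k - y l\<bar> + (M - N) * \<bar>indicator S k - indicator S l\<bar> = \<bar>x k - x l\<bar>"
        using N[of k] N[of l] \<open>N < M\<close> by (auto simp: y_def S_def indicator_def)
      then show "m k l * (\<bar>y k - y l\<bar> + (M - N) * \<bar>indicator S k - indicator S l\<bar>) = m k l * \<bar>x k - x l\<bar>"
        by simp
    qed
    finally show ?thesis .
  qed
qed

text \<open>Twice the signed area of the triangle with vertices \<open>(x i, y i)\<close>, \<open>(x j, y j)\<close>, \<open>(x k, y k)\<close>.\<close>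

definition area :: "('i \<Rightarrow> real) \<Rightarrow> ('i \<Rightarrow> real) \<Rightarrow> 'i \<Rightarrow> 'i \<Rightarrow> 'i \<Rightarrow> real" where
  "area x y i j k = (x j - x i) * (y k - y i) - (x k - x i) * (y j - y i)"

lemma sum_over_classes:
  fixes w :: "'i \<Rightarrow> real"
  shows "(\<Sum>i\<in>I. w i * f (i \<in> S) (i \<in> T)) =
    (\<Sum>i\<in>I. w i * of_bool (i \<in> S \<and> i \<in> T)) * f True True
  + (\<Sum>i\<in>I. w i * of_bool (i \<in> S \<and> i \<notin> T)) * f True False
  + (\<Sum>i\<in>I. w i * of_bool (i \<notin> S \<and> i \<in> T)) * f False True
  + (\<Sum>i\<in>I. w i * of_bool (i \<notin> S \<and> i \<notin> T)) * f False False"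
  unfolding sum_distrib_right sum.distrib[symmetric]
  by (rule sum.cong) auto

text \<open>
  Only the masses \<open>p\<close>, \<open>q\<close>, \<open>r\<close>, \<open>s\<close> of the four classes cut out by \<open>S\<close> and \<open>T\<close> matter: the
  points sit at the corners of the unit square, so a triple has area 1 or 0 according to whether
  its corners are distinct.
\<close>

lemma area_inequality_indicator:
  fixes w :: "'i \<Rightarrow> real"
  assumes w: "\<And>i. i \<in> I \<Longrightarrow> 0 \<le> w i"
  shows "2 * (\<Sum>i\<in>I. w i) *
      (\<Sum>i\<in>I. \<Sum>j\<in>I. \<Sum>k\<in>I. w i * w j * w k * \<bar>area (indicator S) (indicator T) i j k\<bar>)
    \<le> 3 * (\<Sum>i\<in>I. \<Sum>j\<in>I. w i * w j * \<bar>indicator S i - indicator S j\<bar>)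
        * (\<Sum>i\<in>I. \<Sum>j\<in>I. w i * w j * \<bar>indicator T i - indicator T j\<bar>)"
proof -
  define p where "p = (\<Sum>i\<in>I. w i * of_bool (i \<in> S \<and> i \<in> T))"
  define q where "q = (\<Sum>i\<in>I. w i * of_bool (i \<in> S \<and> i \<notin> T))"
  define r where "r = (\<Sum>i\<in>I. w i * of_bool (i \<notin> S \<and> i \<in> T))"
  define s where "s = (\<Sum>i\<in>I. w i * of_bool (i \<notin> S \<and> i \<notin> T))"
  \<comment> \<open>\<open>E\<close> integrates against the four class masses. Each sum over
    \<open>I\<close> of a function of class membership becomes an \<open>E\<close>, so nested sums
    turn into explicit polynomials in \<open>p\<close>, \<open>q\<close>, \<open>r\<close>,
    \<open>s\<close>.\<close>
  define E :: "(bool \<Rightarrow> bool \<Rightarrow> real) \<Rightarrow> real" where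
    "E = (\<lambda>f. p * f True True + q * f True False + r * f False True + s * f False False)"
  have E: "(\<Sum>i\<in>I. w i * f (i \<in> S) (i \<in> T)) = E f" for f
    unfolding E_def p_def q_def r_def s_def by (rule sum_over_classes)
  let ?b = "of_bool :: bool \<Rightarrow> real"
  define F :: "bool \<Rightarrow> bool \<Rightarrow> bool \<Rightarrow> bool \<Rightarrow> bool \<Rightarrow> bool \<Rightarrow> real" where
    "F = (\<lambda>a b c d e g. \<bar>(?b c - ?b a) * (?b g - ?b b) - (?b e - ?b a) * (?b d - ?b b)\<bar>)"
  have tot: "(\<Sum>i\<in>I. w i) = p + q + r + s"
    using E[of "\<lambda>_ _. 1"] by (simp add: E_def)
  have "(\<Sum>i\<in>I. \<Sum>j\<in>I. \<Sum>k\<in>I. w i * w j * w k * \<bar>area (indicator S) (indicator T) i j k\<bar>)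
      = (\<Sum>i\<in>I. w i * (\<Sum>j\<in>I. w j * (\<Sum>k\<in>I. w k *
          F (i \<in> S) (i \<in> T) (j \<in> S) (j \<in> T) (k \<in> S) (k \<in> T))))"
    by (simp add: area_def F_def indicator_def of_bool_def sum_distrib_left mult.assoc)
  also have "\<dots> = E (\<lambda>a b. E (\<lambda>c d. E (F a b c d)))"
    by (simp add: E E[of "\<lambda>c d. E (F a b c d)" for a b] E[of "\<lambda>a b. E (\<lambda>c d. E (F a b c d))"])
  \<comment> \<open>There are four ways to choose three distinct corners, each counted in 6
    orders.\<close>
  also have "\<dots> = 6 * (p * q * r + p * q * s + p * r * s + q * r * s)"
    by (simp add: E_def F_def algebra_simps)
  finally have areas: "(\<Sum>i\<in>I. \<Sum>j\<in>I. \<Sum>k\<in>I. w i * w j * w k *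
      \<bar>area (indicator S) (indicator T) i j k\<bar>) = 6 * (p * q * r + p * q * s + p * r * s + q * r * s)" .
  have "(\<Sum>i\<in>I. \<Sum>j\<in>I. w i * w j * \<bar>indicator S i - indicator S j\<bar>)
      = (\<Sum>i\<in>I. w i * (\<Sum>j\<in>I. w j * \<bar>?b (i \<in> S) - ?b (j \<in> S)\<bar>))"
    by (simp add: indicator_def of_bool_def sum_distrib_left mult.assoc)
  also have "\<dots> = E (\<lambda>a b. E (\<lambda>c d. \<bar>?b a - ?b c\<bar>))"
    by (simp add: E[of "\<lambda>a b. E (\<lambda>c d. \<bar>?b a - ?b c\<bar>)"] E[of "\<lambda>c d. \<bar>?b a - ?b c\<bar>" for a])
  also have "\<dots> = 2 * ((p + q) * (r + s))"
    by (simp add: E_def algebra_simps)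
  finally have widthS: "(\<Sum>i\<in>I. \<Sum>j\<in>I. w i * w j * \<bar>indicator S i - indicator S j\<bar>)
      = 2 * ((p + q) * (r + s))" .
  have "(\<Sum>i\<in>I. \<Sum>j\<in>I. w i * w j * \<bar>indicator T i - indicator T j\<bar>)
      = (\<Sum>i\<in>I. w i * (\<Sum>j\<in>I. w j * \<bar>?b (i \<in> T) - ?b (j \<in> T)\<bar>))"
    by (simp add: indicator_def of_bool_def sum_distrib_left mult.assoc)
  also have "\<dots> = E (\<lambda>a b. E (\<lambda>c d. \<bar>?b b - ?b d\<bar>))"
    by (simp add: E[of "\<lambda>a b. E (\<lambda>c d. \<bar>?b b - ?b d\<bar>)"] E[of "\<lambda>c d. \<bar>?b b - ?b d\<bar>" for b])
  also have "\<dots> = 2 * ((p + r) * (q + s))"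
    by (simp add: E_def algebra_simps)
  finally have widthT: "(\<Sum>i\<in>I. \<Sum>j\<in>I. w i * w j * \<bar>indicator T i - indicator T j\<bar>)
      = 2 * ((p + r) * (q + s))" .
  \<comment> \<open>After dividing by 12, the claim is exactly that this square is nonnegative.\<close>
  have "(p + q) * (r + s) * ((p + r) * (q + s))
      - (p + q + r + s) * (p * q * r + p * q * s + p * r * s + q * r * s) = (p * s - q * r)\<^sup>2"
    by (simp add: power2_eq_square algebra_simps)
  then have "(p + q + r + s) * (p * q * r + p * q * s + p * r * s + q * r * s)
      \<le> (p + q) * (r + s) * ((p + r) * (q + s))"
    using zero_le_power2[of "p * s - q * r"] by linarith
  moreover have "2 * t * (6 * e) = 12 * (t * e)" "3 * (2 * u) * (2 * v) = 12 * (u * v)" for t e u v :: real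
    by simp_all
  ultimately show ?thesis
    unfolding areas widthS widthT tot by (simp only: mult_le_cancel_left_pos zero_less_numeral)
qed

section \<open>From indicators to arbitrary coordinates\<close>

lemma area_add: "area (\<lambda>i. f i + g i) y i j k = area f y i j k + area g y i j k"
  by (simp add: area_def algebra_simps)

lemma area_mult: "area (\<lambda>i. c * f i) y i j k = c * area f y i j k"
  by (simp add: area_def algebra_simps)

lemma abs_area_commute: "\<bar>area x y i j k\<bar> = \<bar>area y x i j k\<bar>"
  by (simp add: area_def abs_minus_commute mult.commute)

text \<open>For fixed \<open>y\<close>, \<open>area\<close> is linear in \<open>x\<close> and
  vanishes on constants, so the weighted sum of its absolute values is a seminorm to which
  \<open>layer_cake_bound\<close> applies. The constant \<open>C\<close> stands for the factor
  belonging to the other coordinate.\<close>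

lemma area_layer_bound:
  fixes w :: "'i \<Rightarrow> real"
  assumes "finite I" and w: "\<And>i. i \<in> I \<Longrightarrow> 0 \<le> w i"
    and ind: "\<And>S. 2 * (\<Sum>i\<in>I. w i) * (\<Sum>i\<in>I. \<Sum>j\<in>I. \<Sum>k\<in>I. w i * w j * w k * \<bar>area (indicator S) y i j k\<bar>)
      \<le> 3 * (\<Sum>i\<in>I. \<Sum>j\<in>I. w i * w j * \<bar>indicator S i - indicator S j\<bar>) * C"
  shows "2 * (\<Sum>i\<in>I. w i) * (\<Sum>i\<in>I. \<Sum>j\<in>I. \<Sum>k\<in>I. w i * w j * w k * \<bar>area x y i j k\<bar>)
      \<le> 3 * (\<Sum>i\<in>I. \<Sum>j\<in>I. w i * w j * \<bar>x i - x j\<bar>) * C"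
proof -
  define \<Phi> where "\<Phi> = (\<lambda>x. 2 * (\<Sum>i\<in>I. w i) * (\<Sum>i\<in>I. \<Sum>j\<in>I. \<Sum>k\<in>I. w i * w j * w k * \<bar>area x y i j k\<bar>))"
  have W: "0 \<le> (\<Sum>i\<in>I. w i)" using w by (rule sum_nonneg)
  have eq: "(\<Sum>k\<in>I. \<Sum>l\<in>I. (3 * C * w k * w l) * \<bar>f k - f l\<bar>)
      = 3 * (\<Sum>i\<in>I. \<Sum>j\<in>I. w i * w j * \<bar>f i - f j\<bar>) * C" for f :: "'i \<Rightarrow> real"
    by (simp add: sum_distrib_left sum_distrib_right algebra_simps)
  have "\<Phi> x \<le> (\<Sum>k\<in>I. \<Sum>l\<in>I. (3 * C * w k * w l) * \<bar>x k - x l\<bar>)"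
  proof (rule layer_cake_bound[OF \<open>finite I\<close>])
    fix f g :: "'i \<Rightarrow> real"
    show "\<Phi> f = \<Phi> g" if "\<And>i. i \<in> I \<Longrightarrow> f i = g i"
      using that by (simp add: \<Phi>_def area_def)
    have "(\<Sum>i\<in>I. \<Sum>j\<in>I. \<Sum>k\<in>I. w i * w j * w k * \<bar>area (\<lambda>i. f i + g i) y i j k\<bar>)
        \<le> (\<Sum>i\<in>I. \<Sum>j\<in>I. \<Sum>k\<in>I. w i * w j * w k * \<bar>area f y i j k\<bar> + w i * w j * w k * \<bar>area g y i j k\<bar>)"
      unfolding area_add distrib_left[symmetric]
      by (intro sum_mono mult_left_mono abs_triangle_ineq mult_nonneg_nonneg w)
    then have "\<Phi> (\<lambda>i. f i + g i) \<le> 2 * (\<Sum>i\<in>I. w i) * (\<Sum>i\<in>I. \<Sum>j\<in>I. \<Sum>k\<in>I.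
        w i * w j * w k * \<bar>area f y i j k\<bar> + w i * w j * w k * \<bar>area g y i j k\<bar>)"
      unfolding \<Phi>_def using W by (intro mult_left_mono) auto
    then show "\<Phi> (\<lambda>i. f i + g i) \<le> \<Phi> f + \<Phi> g"
      by (simp add: \<Phi>_def sum.distrib distrib_left)
  next
    fix c :: real and f :: "'i \<Rightarrow> real" assume "0 \<le> c"
    then show "\<Phi> (\<lambda>i. c * f i) \<le> c * \<Phi> f"
      by (simp add: \<Phi>_def area_mult abs_mult sum_distrib_left mult.left_commute)
  next
    fix c :: real show "\<Phi> (\<lambda>i. c) \<le> 0"
      by (simp add: \<Phi>_def area_def)
  next
    fix S assume "S \<subseteq> I"
    show "\<Phi> (indicator S) \<le> (\<Sum>k\<in>I. \<Sum>l\<in>I. (3 * C * w k * w l) * \<bar>indicator S k - indicator S l\<bar>)"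
      unfolding eq \<Phi>_def by (rule ind)
  qed
  then show ?thesis unfolding eq \<Phi>_def .
qed

text \<open>The layer argument is used once per coordinate: it first replaces \<open>x\<close> by an
  indicator, then, with the roles exchanged by \<open>abs_area_commute\<close>, also
  \<open>y\<close>, which leaves \<open>area_inequality_indicator\<close>.\<close>

lemma area_inequality:
  fixes w :: "'i \<Rightarrow> real"
  assumes "finite I" and w: "\<And>i. i \<in> I \<Longrightarrow> 0 \<le> w i"
  shows "2 * (\<Sum>i\<in>I. w i) * (\<Sum>i\<in>I. \<Sum>j\<in>I. \<Sum>k\<in>I. w i * w j * w k * \<bar>area x y i j k\<bar>)
      \<le> 3 * (\<Sum>i\<in>I. \<Sum>j\<in>I. w i * w j * \<bar>x i - x j\<bar>) * (\<Sum>i\<in>I. \<Sum>j\<in>I. w i * w j * \<bar>y i - y j\<bar>)"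
proof (rule area_layer_bound[OF assms])
  fix S
  have "2 * (\<Sum>i\<in>I. w i) * (\<Sum>i\<in>I. \<Sum>j\<in>I. \<Sum>k\<in>I. w i * w j * w k * \<bar>area y (indicator S) i j k\<bar>)
      \<le> 3 * (\<Sum>i\<in>I. \<Sum>j\<in>I. w i * w j * \<bar>y i - y j\<bar>)
        * (\<Sum>i\<in>I. \<Sum>j\<in>I. w i * w j * \<bar>indicator S i - indicator S j\<bar>)"
    by (rule area_layer_bound[OF assms]) (use area_inequality_indicator[of I w] w in auto)
  then show "2 * (\<Sum>i\<in>I. w i) * (\<Sum>i\<in>I. \<Sum>j\<in>I. \<Sum>k\<in>I. w i * w j * w k * \<bar>area (indicator S) y i j k\<bar>)
      \<le> 3 * (\<Sum>i\<in>I. \<Sum>j\<in>I. w i * w j * \<bar>indicator S i - indicator S j\<bar>)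
        * (\<Sum>i\<in>I. \<Sum>j\<in>I. w i * w j * \<bar>y i - y j\<bar>)"
    by (simp add: abs_area_commute[of y] mult.commute mult.left_commute)
qed

section \<open>Submodularity for zonotopes\<close>

lemma det3_scaleR: "det3 (a *\<^sub>R u) (b *\<^sub>R v) (c *\<^sub>R w) = a * b * c * det3 u v w"
  by (simp add: det3_def algebra_simps)

lemma det3_inequality_pos:
  fixes u :: "'i \<Rightarrow> real^3"
  assumes "finite I" and pos: "\<And>i. i \<in> I \<Longrightarrow> 0 < u i $ 3"
  shows "2 * (\<Sum>i\<in>I. \<bar>u i $ 3\<bar>) * (\<Sum>i\<in>I. \<Sum>j\<in>I. \<Sum>k\<in>I. \<bar>det3 (u i) (u j) (u k)\<bar>)
      \<le> 3 * (\<Sum>i\<in>I. \<Sum>j\<in>I. \<bar>det3 (axis 1 1) (u i) (u j)\<bar>)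
          * (\<Sum>i\<in>I. \<Sum>j\<in>I. \<bar>det3 (axis 2 1) (u i) (u j)\<bar>)"
proof -
  \<comment> \<open>\<open>u i\<close> is the point \<open>(x i, y i, 1)\<close> of an affine plane, carrying the weight \<open>w i\<close>.\<close>
  define w where "w = (\<lambda>i. u i $ 3)"
  define x where "x = (\<lambda>i. u i $ 1 / u i $ 3)"
  define y where "y = (\<lambda>i. u i $ 2 / u i $ 3)"
  have u: "u i $ 1 = w i * x i" "u i $ 2 = w i * y i" "u i $ 3 = w i" if "i \<in> I" for i
    using pos[OF that] by (simp_all add: w_def x_def y_def)
  have w: "0 \<le> w i" if "i \<in> I" for i using pos[OF that] by (simp add: w_def)
  have 1: "\<bar>det3 (u i) (u j) (u k)\<bar> = w i * w j * w k * \<bar>area x y i j k\<bar>"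
    if "i \<in> I" "j \<in> I" "k \<in> I" for i j k
  proof -
    have "det3 (u i) (u j) (u k) = w i * w j * w k * area x y i j k"
      using that by (simp add: det3_def area_def u algebra_simps)
    then show ?thesis using that w by (simp add: abs_mult)
  qed
  \<comment> \<open>The coordinates trade places: projecting along the first axis leaves the
    differences of \<open>y\<close>, and along the second those of \<open>x\<close>.\<close>
  have 2: "\<bar>det3 (axis 1 1) (u i) (u j)\<bar> = w i * w j * \<bar>y i - y j\<bar>" if "i \<in> I" "j \<in> I" for i j
  proof -
    have "det3 (axis 1 1) (u i) (u j) = w i * w j * (y i - y j)"
      using that by (simp add: det3_def axis_def u algebra_simps)
    then show ?thesis using that w by (simp add: abs_mult)
  qed
  have 3: "\<bar>det3 (axis 2 1) (u i) (u j)\<bar> = w i * w j * \<bar>x i - x j\<bar>" if "i \<in> I" "j \<in> I" for i j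
  proof -
    have "det3 (axis 2 1) (u i) (u j) = w i * w j * (x j - x i)"
      using that by (simp add: det3_def axis_def u algebra_simps)
    then show ?thesis using that w by (simp add: abs_mult abs_minus_commute)
  qed
  have 4: "(\<Sum>i\<in>I. \<bar>u i $ 3\<bar>) = (\<Sum>i\<in>I. w i)" using w by (simp add: u)
  show ?thesis
    using area_inequality[OF \<open>finite I\<close>, of w x y] w by (simp add: 1 2 3 4 mult.commute mult.left_commute)
qed

text \<open>Vectors in the plane \<open>x $ 3 = 0\<close> are reached by continuity.\<close>

lemma det3_inequality_nonneg:
  fixes u :: "'i \<Rightarrow> real^3"
  assumes "finite I" and nonneg: "\<And>i. i \<in> I \<Longrightarrow> 0 \<le> u i $ 3"
  shows "2 * (\<Sum>i\<in>I. \<bar>u i $ 3\<bar>) * (\<Sum>i\<in>I. \<Sum>j\<in>I. \<Sum>k\<in>I. \<bar>det3 (u i) (u j) (u k)\<bar>)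
      \<le> 3 * (\<Sum>i\<in>I. \<Sum>j\<in>I. \<bar>det3 (axis 1 1) (u i) (u j)\<bar>)
          * (\<Sum>i\<in>I. \<Sum>j\<in>I. \<bar>det3 (axis 2 1) (u i) (u j)\<bar>)"
proof -
  define v where "v = (\<lambda>e i. u i + e *\<^sub>R axis 3 (1::real))"
  define F where "F = (\<lambda>e. 3 * (\<Sum>i\<in>I. \<Sum>j\<in>I. \<bar>det3 (axis 1 1) (v e i) (v e j)\<bar>)
          * (\<Sum>i\<in>I. \<Sum>j\<in>I. \<bar>det3 (axis 2 1) (v e i) (v e j)\<bar>)
      - 2 * (\<Sum>i\<in>I. \<bar>v e i $ 3\<bar>) * (\<Sum>i\<in>I. \<Sum>j\<in>I. \<Sum>k\<in>I. \<bar>det3 (v e i) (v e j) (v e k)\<bar>))"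
  have "continuous_on UNIV F"
    unfolding F_def v_def det3_def by (simp, intro continuous_intros)
  then have "(F \<longlongrightarrow> F 0) (at_right 0)"
    by (metis UNIV_I continuous_on_def open_UNIV tendsto_within_subset subset_UNIV)
  moreover have "eventually (\<lambda>e. 0 \<le> F e) (at_right 0)"
  proof (rule eventually_at_right_less[THEN eventually_mono])
    fix e :: real assume "0 < e"
    then have "0 < v e i $ 3" if "i \<in> I" for i using nonneg[OF that] by (simp add: v_def axis_def)
    then show "0 \<le> F e"
      using det3_inequality_pos[OF \<open>finite I\<close>, of "v e"] by (simp add: F_def)
  qed
  ultimately have "0 \<le> F 0"
    by (intro tendsto_lowerbound[of F "F 0" "at_right 0"]) auto
  then show ?thesis by (simp add: F_def v_def)
qed

text \<open>Every term is an absolute value and is unchanged when some \<open>u i\<close> is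
  replaced by its negative, so all third coordinates may be made nonnegative.\<close>

lemma det3_inequality_axis:
  fixes u :: "'i \<Rightarrow> real^3"
  assumes "finite I"
  shows "2 * (\<Sum>i\<in>I. \<bar>u i $ 3\<bar>) * (\<Sum>i\<in>I. \<Sum>j\<in>I. \<Sum>k\<in>I. \<bar>det3 (u i) (u j) (u k)\<bar>)
      \<le> 3 * (\<Sum>i\<in>I. \<Sum>j\<in>I. \<bar>det3 (axis 1 1) (u i) (u j)\<bar>)
          * (\<Sum>i\<in>I. \<Sum>j\<in>I. \<bar>det3 (axis 2 1) (u i) (u j)\<bar>)"
proof -
  define \<sigma> :: "'i \<Rightarrow> real" where "\<sigma> = (\<lambda>i. if u i $ 3 < 0 then -1 else 1)"
  have \<sigma>: "\<bar>\<sigma> i\<bar> = 1" "0 \<le> \<sigma> i * u i $ 3" "\<sigma> i * u i $ 3 = \<bar>u i $ 3\<bar>" for i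
    by (simp_all add: \<sigma>_def)
  have [simp]: "\<bar>det3 (\<sigma> i *\<^sub>R p) q r\<bar> = \<bar>det3 p q r\<bar>" "\<bar>det3 p (\<sigma> i *\<^sub>R q) r\<bar> = \<bar>det3 p q r\<bar>"
    "\<bar>det3 p q (\<sigma> i *\<^sub>R r)\<bar> = \<bar>det3 p q r\<bar>" for p q r i
    using det3_scaleR[of "\<sigma> i" p 1 q 1 r] det3_scaleR[of 1 p "\<sigma> i" q 1 r] det3_scaleR[of 1 p 1 q "\<sigma> i" r]
    by (simp_all add: abs_mult \<sigma>)
  show ?thesis
    using det3_inequality_nonneg[OF assms, of "\<lambda>i. \<sigma> i *\<^sub>R u i"] by (simp add: \<sigma>)
qed

text \<open>If \<open>s\<close> and \<open>t\<close> are dependent, the left side is 0. Otherwise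
  they extend to a basis, and the linear map taking the axes to this basis reduces the claim to
  \<open>det3_inequality_axis\<close>.\<close>

lemma det3_inequality:
  fixes u :: "'i \<Rightarrow> real^3"
  assumes "finite I"
  shows "2 * (\<Sum>i\<in>I. \<bar>det3 s t (u i)\<bar>) * (\<Sum>i\<in>I. \<Sum>j\<in>I. \<Sum>k\<in>I. \<bar>det3 (u i) (u j) (u k)\<bar>)
      \<le> 3 * (\<Sum>i\<in>I. \<Sum>j\<in>I. \<bar>det3 s (u i) (u j)\<bar>) * (\<Sum>i\<in>I. \<Sum>j\<in>I. \<bar>det3 t (u i) (u j)\<bar>)"
proof (cases "\<forall>r. det3 s t r = 0")
  case True
  then show ?thesis by (simp add: sum_nonneg)
next
  case False
  then obtain r where r: "det3 s t r \<noteq> 0" by blast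
  define f where "f = (\<lambda>v::real^3. v$1 *\<^sub>R s + v$2 *\<^sub>R t + v$3 *\<^sub>R r)"
  have lf: "linear f" by (auto intro!: linearI simp: f_def algebra_simps)
  have f: "f (axis 1 1) = s" "f (axis 2 1) = t" "f (axis 3 1) = r"
    by (simp_all add: f_def axis_def)
  let ?d = "det (matrix f)"
  have "det3 s t r = ?d * det3 (axis 1 1) (axis 2 1) (axis 3 1)"
    using det3_linear[OF lf, of "axis 1 1" "axis 2 1" "axis 3 1"] by (simp add: f)
  with r have "?d \<noteq> 0" by auto
  then have "inj f" using det_nz_iff_inj[OF lf] by blast
  then have "surj f" using linear_injective_imp_surjective[OF lf] by blast
  define c where "c = (\<lambda>i. inv f (u i))"
  have c: "u i = f (c i)" for i using \<open>surj f\<close> by (simp add: c_def surj_f_inv_f)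
  have S: "det3 s p q = ?d * det3 (axis 1 1) p' q'" if "p = f p'" "q = f q'" for p q p' q'
    using det3_linear[OF lf, of "axis 1 1" p' q'] that by (simp add: f)
  have T: "det3 t p q = ?d * det3 (axis 2 1) p' q'" if "p = f p'" "q = f q'" for p q p' q'
    using det3_linear[OF lf, of "axis 2 1" p' q'] that by (simp add: f)
  have ST: "det3 s t (u i) = ?d * c i $ 3" for i
    using S[OF f(2)[symmetric] c] by (simp add: det3_def axis_def)
  \<comment> \<open>Each side is a product of two sums of determinants, so both sides scale by the
    square of \<open>?d\<close>.\<close>
  have "\<bar>?d\<bar> * \<bar>?d\<bar> * (2 * (\<Sum>i\<in>I. \<bar>c i $ 3\<bar>) * (\<Sum>i\<in>I. \<Sum>j\<in>I. \<Sum>k\<in>I. \<bar>det3 (c i) (c j) (c k)\<bar>))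
      \<le> \<bar>?d\<bar> * \<bar>?d\<bar> * (3 * (\<Sum>i\<in>I. \<Sum>j\<in>I. \<bar>det3 (axis 1 1) (c i) (c j)\<bar>)
          * (\<Sum>i\<in>I. \<Sum>j\<in>I. \<bar>det3 (axis 2 1) (c i) (c j)\<bar>))"
    by (intro mult_left_mono det3_inequality_axis assms) simp
  moreover have "(\<Sum>i\<in>I. \<bar>det3 s t (u i)\<bar>) = \<bar>?d\<bar> * (\<Sum>i\<in>I. \<bar>c i $ 3\<bar>)"
    by (simp add: ST abs_mult sum_distrib_left)
  moreover have "(\<Sum>i\<in>I. \<Sum>j\<in>I. \<Sum>k\<in>I. \<bar>det3 (u i) (u j) (u k)\<bar>)
      = \<bar>?d\<bar> * (\<Sum>i\<in>I. \<Sum>j\<in>I. \<Sum>k\<in>I. \<bar>det3 (c i) (c j) (c k)\<bar>)"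
    by (simp add: c det3_linear[OF lf] abs_mult sum_distrib_left)
  moreover have "(\<Sum>i\<in>I. \<Sum>j\<in>I. \<bar>det3 s (u i) (u j)\<bar>)
      = \<bar>?d\<bar> * (\<Sum>i\<in>I. \<Sum>j\<in>I. \<bar>det3 (axis 1 1) (c i) (c j)\<bar>)"
    by (simp add: S[OF c c] abs_mult sum_distrib_left)
  moreover have "(\<Sum>i\<in>I. \<Sum>j\<in>I. \<bar>det3 t (u i) (u j)\<bar>)
      = \<bar>?d\<bar> * (\<Sum>i\<in>I. \<Sum>j\<in>I. \<bar>det3 (axis 2 1) (c i) (c j)\<bar>)"
    by (simp add: T[OF c c] abs_mult sum_distrib_left)
  ultimately show ?thesis by (simp only: mult_ac)
qed

section \<open>From determinants to volumes\<close>

lemma sum_list_map_eq_sum: "(\<Sum>u\<leftarrow>us. f u) = (\<Sum>i<length us. f (us ! i))"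
  by (simp add: sum_list_sum_nth atLeast0LessThan)

text \<open>In the notation of the proof, right side minus left side is
  \<open>A s * A t / 4 - V us * L\<close>: all other terms cancel. Its nonnegativity is
  \<open>det3_inequality\<close> combined with the volume formula.\<close>

lemma volume_segment_submodular:
  fixes us :: "(real^3) list"
  shows "measure lborel (zonotope_of us) * measure lborel (zonotope_of (s # t # us))
    \<le> measure lborel (zonotope_of (s # us)) * measure lborel (zonotope_of (t # us))"
proof -
  define V where "V = (\<lambda>us :: (real^3) list. measure lborel (zonotope_of us))"
  define A where "A = (\<lambda>s. (\<Sum>u\<leftarrow>us. \<Sum>v\<leftarrow>us. \<bar>det3 s u v\<bar>))"
  define L where "L = (\<Sum>u\<leftarrow>us. \<bar>det3 s t u\<bar>)"
  have Vs: "2 * V (r # us) = 2 * V us + A r" for r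
    unfolding V_def A_def by (rule measure_zonotope_of_Cons_3)
  have "\<bar>det3 s u t\<bar> = \<bar>det3 s t u\<bar>" for u
  proof -
    have "det3 s u t = - det3 s t u" by (simp add: det3_def algebra_simps)
    then show ?thesis by simp
  qed
  moreover have "det3 s t t = 0" by (simp add: det3_def algebra_simps)
  ultimately have "2 * V (s # t # us) = 2 * V (t # us) + (A s + 2 * L)"
    unfolding V_def measure_zonotope_of_Cons_3[of s "t # us"]
    by (simp add: A_def L_def sum_list_addf del: zonotope_of_Cons)
  then have Vst: "V (s # t # us) = V us + A s / 2 + A t / 2 + L"
    using Vs[of t] by simp
  have "2 * L * (6 * V us) \<le> 3 * A s * A t"
    using det3_inequality[of "{..<length us}" s t "\<lambda>i. us ! i"]
    unfolding V_def measure_zonotope_of_3 A_def L_def sum_list_map_eq_sum by simp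
  moreover have "V (s # us) = V us + A s / 2" "V (t # us) = V us + A t / 2"
    using Vs[of s] Vs[of t] by simp_all
  ultimately have "V us * V (s # t # us) \<le> V (s # us) * V (t # us)"
    unfolding Vst by (simp add: algebra_simps)
  then show ?thesis by (simp only: V_def)
qed

text \<open>This permits the cancellations below: the factor to be cancelled is positive unless
  \<open>us\<close> has volume 0.\<close>

lemma measure_lborel_zonotope_of_append_mono:
  "measure lborel (zonotope_of us) \<le> measure lborel (zonotope_of (vs @ us))" for us :: "(real^3) list"
proof (induction vs)
  case (Cons v vs)
  have "0 \<le> (\<Sum>u\<leftarrow>vs @ us. \<Sum>w\<leftarrow>vs @ us. \<bar>det3 v u w\<bar>)" 
    unfolding sum_list_map_eq_sum by (intro sum_nonneg) simp
  with Cons measure_zonotope_of_Cons_3[of v "vs @ us"] show ?case by (simp del: zonotope_of_Cons)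
qed simp

text \<open>The factor gained by adding \<open>s\<close> does not grow as the body gains segments.
  The induction multiplies the one-segment inequality for the body \<open>ts @ us\<close> with the
  hypothesis and cancels the volume of that body.\<close>

lemma volume_segment_list_submodular:
  fixes us :: "(real^3) list"
  shows "measure lborel (zonotope_of us) * measure lborel (zonotope_of (s # ts @ us))
    \<le> measure lborel (zonotope_of (s # us)) * measure lborel (zonotope_of (ts @ us))"
proof (induction ts)
  case (Cons t ts)
  define V where "V = (\<lambda>us :: (real^3) list. measure lborel (zonotope_of us))"
  have IH: "V us * V (s # ts @ us) \<le> V (s # us) * V (ts @ us)"
    using Cons by (simp only: V_def)
  have step: "V (ts @ us) * V (s # t # ts @ us) \<le> V (s # ts @ us) * V (t # ts @ us)"
    unfolding V_def by (rule volume_segment_submodular)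
  have nn: "0 \<le> V xs" for xs by (simp add: V_def)
  have mono: "V us \<le> V (ts @ us)" unfolding V_def by (rule measure_lborel_zonotope_of_append_mono)
  have "V us * V (s # t # ts @ us) \<le> V (s # us) * V (t # ts @ us)"
  proof (cases "V us = 0")
    case True
    then show ?thesis by (simp add: nn)
  next
    case False
    then have "0 < V (ts @ us)" using mono nn[of us] by linarith
    have "V (ts @ us) * (V us * V (s # t # ts @ us)) = V us * (V (ts @ us) * V (s # t # ts @ us))"
      by (simp only: mult.left_commute)
    also have "\<dots> \<le> V us * (V (s # ts @ us) * V (t # ts @ us))"
      by (intro mult_left_mono step nn)
    also have "\<dots> = (V us * V (s # ts @ us)) * V (t # ts @ us)" by (simp only: mult.assoc)
    also have "\<dots> \<le> (V (s # us) * V (ts @ us)) * V (t # ts @ us)"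
      by (intro mult_right_mono IH nn)
    finally show ?thesis
      using \<open>0 < V (ts @ us)\<close> by (simp add: mult.assoc mult.left_commute)
  qed
  then show ?case by (simp only: V_def append_Cons)
qed simp

text \<open>The same multiplication and cancellation, now over \<open>ss\<close>: the segment
  \<open>s\<close> is added to the body \<open>ss @ us\<close> and compared with all of
  \<open>ts\<close> at once.\<close>

lemma volume_zonotope_of_submodular:
  fixes us :: "(real^3) list"
  shows "measure lborel (zonotope_of us) * measure lborel (zonotope_of (ss @ ts @ us))
    \<le> measure lborel (zonotope_of (ss @ us)) * measure lborel (zonotope_of (ts @ us))"
proof (induction ss)
  case (Cons s ss)
  define V where "V = (\<lambda>us :: (real^3) list. measure lborel (zonotope_of us))"
  have IH: "V us * V (ss @ ts @ us) \<le> V (ss @ us) * V (ts @ us)"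
    using Cons by (simp only: V_def)
  have perm: "zonotope_of (s # ts @ ss @ us) = zonotope_of (s # ss @ ts @ us)"
    "zonotope_of (ts @ ss @ us) = zonotope_of (ss @ ts @ us)"
    by (simp_all add: zonotope_of_append add.left_commute)
  have step: "V (ss @ us) * V (s # ss @ ts @ us) \<le> V (s # ss @ us) * V (ss @ ts @ us)"
    using volume_segment_list_submodular[of "ss @ us" s ts] unfolding perm V_def .
  have nn: "0 \<le> V xs" for xs by (simp add: V_def)
  have mono: "V us \<le> V (ss @ us)" unfolding V_def by (rule measure_lborel_zonotope_of_append_mono)
  have "V us * V (s # ss @ ts @ us) \<le> V (s # ss @ us) * V (ts @ us)"
  proof (cases "V us = 0")
    case True
    then show ?thesis by (simp add: nn)
  next
    case False
    then have "0 < V (ss @ us)" using mono nn[of us] by linarith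
    have "V (ss @ us) * (V us * V (s # ss @ ts @ us)) = V us * (V (ss @ us) * V (s # ss @ ts @ us))"
      by (simp only: mult.left_commute)
    also have "\<dots> \<le> V us * (V (s # ss @ us) * V (ss @ ts @ us))"
      by (intro mult_left_mono step nn)
    also have "\<dots> = V (s # ss @ us) * (V us * V (ss @ ts @ us))" by (simp only: mult.left_commute)
    also have "\<dots> \<le> V (s # ss @ us) * (V (ss @ us) * V (ts @ us))"
      by (intro mult_left_mono IH nn)
    finally show ?thesis
      using \<open>0 < V (ss @ us)\<close> by (simp add: mult.left_commute)
  qed
  then show ?case by (simp only: V_def append_Cons)
qed simp

section \<open>Approximation of zonoids\<close>

text \<open>Each segment is its first endpoint plus a segment from 0; the endpoints add up to
  \<open>p\<close>.\<close>

lemma zonotope_eq_translate_zonotope_of: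
  assumes "zonotope Z"
  obtains p us where "Z = {p} + zonotope_of us"
proof -
  obtain n :: nat and a b where Z: "Z = (\<Sum>i<n. closed_segment (a i) (b i))"
    using assms unfolding zonotope_def by blast
  have "\<exists>p us. (\<Sum>i<n. closed_segment (a i) (b i)) = {p} + zonotope_of us"
  proof (induction n)
    case 0
    have "(\<Sum>i<0::nat. closed_segment (a i) (b i)) = {0} + zonotope_of []"
      by (simp add: set_plus_def)
    then show ?case by blast
  next
    case (Suc n)
    then obtain p us where "(\<Sum>i<n. closed_segment (a i) (b i)) = {p} + zonotope_of us" by blast
    moreover have "closed_segment (a n) (b n) = {a n} + closed_segment 0 (b n - a n)"
      using closed_segment_translation[of "a n" 0 "b n - a n"] by (auto simp: set_plus_def)
    moreover have "{p} + {a n} = {p + a n}" by (simp add: set_plus_def)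
    ultimately have "(\<Sum>i<Suc n. closed_segment (a i) (b i)) = {p + a n} + zonotope_of ((b n - a n) # us)"
      by (simp add: ac_simps flip: \<open>{p} + {a n} = {p + a n}\<close>)
    then show ?case by blast
  qed
  with Z that show ?thesis by blast
qed

lemma translate_zonotope_of_plus:
  "({p} + zonotope_of us) + ({q} + zonotope_of vs) = {p + q} + zonotope_of (vs @ us)"
proof -
  have "{p + q} = {p} + {q}" by (simp add: set_plus_def)
  then show ?thesis by (simp add: zonotope_of_append ac_simps)
qed

lemma measure_translate_zonotope_of:
  "measure lebesgue ({p} + zonotope_of us) = measure lborel (zonotope_of us)"
proof -
  have "{p} + zonotope_of us = (+) p ` zonotope_of us" by (auto simp: set_plus_def)
  then show ?thesis
    by (simp add: measure_translation measure_lebesgue_eq_lborel_compact compact_zonotope_of)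
qed

lemma compact_translate_zonotope_of: "compact ({p} + zonotope_of us)"
  by (intro compact_set_plus compact_zonotope_of) simp

lemma zonotope_of_nonempty: "zonotope_of us \<noteq> {}"
  by (induction us) (auto simp: set_plus_def)

text \<open>The cube of half-side \<open>d\<close> is a sum of segments along the basis vectors. It
  replaces the ball when a zonotope is to be thickened within the class of zonotopes.\<close>

lemma exists_zonotope_between_balls:
  fixes d :: real
  assumes "0 \<le> d"
  obtains Z :: "'a::euclidean_space set" where "zonotope Z" "cball 0 d \<subseteq> Z" "Z \<subseteq> cball 0 (DIM('a) * d)"
proof
  let ?S = "\<lambda>b::'a. closed_segment ((- d) *\<^sub>R b) (d *\<^sub>R b)"
  let ?Z = "sum ?S Basis"
  obtain h :: "nat \<Rightarrow> 'a" and n where "bij_betw h {..<n} Basis"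
    using ex_bij_betw_nat_finite[of "Basis :: 'a set"] by (auto simp: atLeast0LessThan)
  then have "?Z = (\<Sum>i<n. ?S (h i))" by (rule sum.reindex_bij_betw[symmetric])
  then show "zonotope ?Z" unfolding zonotope_def
    by (intro exI[of _ n] exI[of _ "\<lambda>i. (- d) *\<^sub>R h i"] exI[of _ "\<lambda>i. d *\<^sub>R h i"])
  have Z: "?Z = {sum s Basis |s. \<forall>b\<in>Basis. s b \<in> ?S b}" by (rule set_sum_alt) simp
  have S: "x *\<^sub>R b \<in> ?S b" if "\<bar>x\<bar> \<le> d" for x b
  proof (cases "d = 0")
    case False
    \<comment> \<open>The affine parameter of \<open>x\<close> in the interval from
      \<open>- d\<close> to \<open>d\<close>.\<close>
    have "x *\<^sub>R b = (1 - (x + d) / (2 * d)) *\<^sub>R ((- d) *\<^sub>R b) + ((x + d) / (2 * d)) *\<^sub>R (d *\<^sub>R b)"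
      using False by (simp add: field_simps flip: scaleR_add_left)
    moreover have "0 \<le> (x + d) / (2 * d)" "(x + d) / (2 * d) \<le> 1"
      using that False assms by (auto simp: field_simps)
    ultimately show ?thesis unfolding closed_segment_def by blast
  qed (use that in auto)
  show "cball 0 d \<subseteq> ?Z"
  proof
    fix x :: 'a assume x: "x \<in> cball 0 d"
    have "x = (\<Sum>b\<in>Basis. (x \<bullet> b) *\<^sub>R b)" by (simp add: euclidean_representation)
    moreover have "(x \<bullet> b) *\<^sub>R b \<in> ?S b" if "b \<in> Basis" for b
      using Basis_le_norm[OF that, of x] x by (intro S) simp
    ultimately show "x \<in> ?Z" unfolding Z by blast
  qed
  show "?Z \<subseteq> cball 0 (DIM('a) * d)"
  proof
    fix x assume "x \<in> ?Z"
    then obtain s where s: "x = sum s Basis" "\<And>b. b \<in> Basis \<Longrightarrow> s b \<in> ?S b" unfolding Z by blast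
    have "norm (s b) \<le> d" if "b \<in> Basis" for b
    proof -
      have "?S b \<subseteq> cball 0 d"
        using that assms by (intro closed_segment_subset) auto
      then show ?thesis using s(2)[OF that] by auto
    qed
    then have "norm x \<le> (\<Sum>b\<in>(Basis::'a set). d)" unfolding s by (rule sum_norm_le)
    then show "x \<in> cball 0 (DIM('a) * d)" by simp
  qed
qed

text \<open>Compactness bounds the distances; a real \<open>SUP\<close> dominates its members only
  for a family bounded above.\<close>

lemma infdist_le_Sup_infdist:
  fixes S T :: "'a::metric_space set"
  assumes "compact S" "x \<in> S"
  shows "infdist x T \<le> (SUP x\<in>S. infdist x T)"
proof (rule cSUP_upper[OF assms(2)])
  have "compact ((\<lambda>x. infdist x T) ` S)"
    by (intro compact_continuous_image continuous_intros assms)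
  then show "bdd_above ((\<lambda>x. infdist x T) ` S)"
    by (intro bounded_imp_bdd_above compact_imp_bounded)
qed

lemma subset_plus_cball:
  fixes S T :: "'a::euclidean_space set"
  assumes "compact S" "compact T" "T \<noteq> {}" "(SUP x\<in>S. infdist x T) \<le> d"
  shows "S \<subseteq> T + cball 0 d"
proof
  fix x assume "x \<in> S"
  then have "infdist x T \<le> d" using infdist_le_Sup_infdist[OF assms(1), of x T] assms(4) by linarith
  moreover obtain t where "t \<in> T" "infdist x T = dist x t"
    using infdist_attains_inf[of T x] assms by (auto simp: compact_imp_closed)
  ultimately have "x - t \<in> cball 0 d" by (simp add: dist_norm norm_minus_commute)
  with \<open>t \<in> T\<close> have "t + (x - t) \<in> T + cball 0 d" by (rule set_plus_intro)
  then show "x \<in> T + cball 0 d" by simp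
qed

lemma cball_plus_cball_subset: "cball 0 r + cball 0 s \<subseteq> cball (0 :: 'a::real_normed_vector) (r + s)"
  by (auto simp: set_plus_def intro!: norm_triangle_le add_mono)

text \<open>
  Approximating from outside makes upper semicontinuity of the volume sufficient, so that no
  convexity is needed in the passage to the limit.
\<close>

lemma zonoid_outer_approximation:
  fixes K :: "'a::euclidean_space set"
  assumes "zonoid K" "0 < e"
  obtains p us where "K \<subseteq> {p} + zonotope_of us" "{p} + zonotope_of us \<subseteq> K + cball 0 e"
proof -
  \<comment> \<open>The approximating zonotope costs an error \<open>d\<close> and the cube added to
    it at most \<open>DIM('a) * d\<close>, together \<open>e\<close>.\<close>
  define d where "d = e / (real DIM('a) + 1)"
  have "0 < real DIM('a) + 1" by linarith
  then have "0 < d" "(real DIM('a) + 1) * d = e"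
    using \<open>0 < e\<close> unfolding d_def by simp_all
  then have d: "0 < d" "d + DIM('a) * d = e"
    by (simp_all add: distrib_right)
  from assms obtain Z where K: "K \<noteq> {}" "compact K"
    and Z: "\<And>n::nat. zonotope (Z n)" "(\<lambda>n. hausdorff_dist (Z n) K) \<longlonglongrightarrow> 0"
    by (auto simp: zonoid_def)
  from order_tendstoD(2)[OF Z(2) d(1)] obtain n where "hausdorff_dist (Z n) K < d"
    by (auto simp: eventually_sequentially)
  then have hd: "(SUP x\<in>Z n. infdist x K) \<le> d" "(SUP x\<in>K. infdist x (Z n)) \<le> d"
    by (auto simp: hausdorff_dist_def)
  obtain p us where p: "Z n = {p} + zonotope_of us"
    using zonotope_eq_translate_zonotope_of[OF Z(1)] .
  have Zn: "compact (Z n)" "Z n \<noteq> {}"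
    using zonotope_of_nonempty[of us] unfolding p
    by (simp_all add: compact_translate_zonotope_of) (auto simp: set_plus_def)
  \<comment> \<open>\<open>Z n\<close> is near \<open>K\<close> but need not contain it; adding the
    cube \<open>C\<close> makes it do so.\<close>
  obtain C :: "'a set" where C: "zonotope C" "cball 0 d \<subseteq> C" "C \<subseteq> cball 0 (DIM('a) * d)"
    using exists_zonotope_between_balls[of d] d by auto
  obtain q vs where q: "C = {q} + zonotope_of vs"
    using zonotope_eq_translate_zonotope_of[OF C(1)] .
  have eq: "Z n + C = {p + q} + zonotope_of (vs @ us)"
    unfolding p q by (rule translate_zonotope_of_plus)
  have "K \<subseteq> Z n + cball 0 d" using K Zn hd by (intro subset_plus_cball)
  also have "\<dots> \<subseteq> Z n + C" using C by (intro set_plus_mono2) auto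
  finally have 1: "K \<subseteq> Z n + C" .
  have "Z n + C \<subseteq> (K + cball 0 d) + cball 0 (DIM('a) * d)"
    using K Zn hd C by (intro set_plus_mono2 subset_plus_cball)
  also have "\<dots> = K + (cball 0 d + cball 0 (DIM('a) * d))" by (rule add.assoc)
  also have "\<dots> \<subseteq> K + cball 0 e"
    using cball_plus_cball_subset[of d "DIM('a) * d"] d by (intro set_plus_mono2) auto
  finally have 2: "Z n + C \<subseteq> K + cball 0 e" .
  show ?thesis using that 1 2 unfolding eq .
qed

text \<open>Outer regularity gives an open set around \<open>C\<close> of nearly the same measure,
  and by compactness it contains a whole neighbourhood \<open>C + cball 0 e\<close>.\<close>

lemma measure_upper_semicontinuous:
  fixes C :: "'a::euclidean_space set"
  assumes "compact C" "0 < \<eta>"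
  obtains e where "0 < e"
    "\<And>S. compact S \<Longrightarrow> S \<subseteq> C + cball 0 e \<Longrightarrow> measure lebesgue S \<le> measure lebesgue C + \<eta>"
proof -
  have C: "C \<in> lmeasurable" by (simp add: lmeasurable_compact assms)
  then obtain T where T: "open T" "C \<subseteq> T" and TC: "T - C \<in> lmeasurable" "emeasure lebesgue (T - C) < ennreal \<eta>"
    using sets_lebesgue_outer_open[of C \<eta>] assms by blast
  have "measure lebesgue (T - C) < \<eta>"
    using TC by (simp add: emeasure_eq_measure2 ennreal_less_iff)
  moreover have "T = (T - C) \<union> C" using T by blast
  then have "T \<in> lmeasurable" using fmeasurable.Un[OF TC(1) C] by simp
  ultimately have Tm: "T \<in> lmeasurable" "measure lebesgue T < measure lebesgue C + \<eta>"
    using measurable_measure_Diff[OF \<open>T \<in> lmeasurable\<close> fmeasurableD[OF C] T(2)] by simp_all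
  obtain e where e: "0 < e" "(\<Union>x\<in>C. cball x e) \<subseteq> T"
    using compact_subset_open_imp_cball_epsilon_subset[OF assms(1) T(1,2)] by blast
  have "C + cball 0 e \<subseteq> T"
  proof
    fix x assume "x \<in> C + cball 0 e"
    then obtain c b where cb: "x = c + b" "c \<in> C" "b \<in> cball 0 e" by (auto elim: set_plus_elim)
    then have "x \<in> cball c e" by (simp add: dist_norm)
    with cb e show "x \<in> T" by blast
  qed
  then have "measure lebesgue S \<le> measure lebesgue C + \<eta>" if "compact S" "S \<subseteq> C + cball 0 e" for S
  proof -
    have "measure lebesgue S \<le> measure lebesgue T"
      using \<open>C + cball 0 e \<subseteq> T\<close> that Tm fmeasurableD[OF lmeasurable_compact[of S]]
      by (intro measure_mono_fmeasurable) auto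
    then show ?thesis using Tm by linarith
  qed
  with e that show ?thesis by blast
qed

lemma plus_cball_plus_cball_subset:
  fixes A B :: "'a::real_normed_vector set"
  assumes "A' \<subseteq> A + cball 0 r" "B' \<subseteq> B + cball 0 s" "r + s \<le> t"
  shows "A' + B' \<subseteq> (A + B) + cball 0 t"
proof -
  have "A' + B' \<subseteq> (A + cball 0 r) + (B + cball 0 s)" using assms by (intro set_plus_mono2)
  also have "\<dots> = (A + B) + (cball 0 r + cball 0 s)" by (simp add: ac_simps)
  also have "\<dots> \<subseteq> (A + B) + cball 0 t"
    using cball_plus_cball_subset[of r s] assms(3) by (intro set_plus_mono2) force+
  finally show ?thesis .
qed

lemma measure_lebesgue_mono_compact:
  fixes S T :: "'a::euclidean_space set"
  assumes "compact S" "compact T" "S \<subseteq> T"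
  shows "measure lebesgue S \<le> measure lebesgue T"
  using assms by (intro measure_mono_fmeasurable) (auto simp: lmeasurable_compact borel_compact)

theorem mainTheorem7:
  fixes A B\<^sub>1 B\<^sub>2 :: "(real ^ 3) set"
  assumes "zonoid A" and "zonoid B\<^sub>1" and "zonoid B\<^sub>2"
  shows "measure lebesgue A * measure lebesgue (A + B\<^sub>1 + B\<^sub>2)
       \<le> measure lebesgue (A + B\<^sub>1) * measure lebesgue (A + B\<^sub>2)"
proof -
  have cA: "compact A" and cB1: "compact B\<^sub>1" and cB2: "compact B\<^sub>2"
    using assms by (auto simp: zonoid_def)
  let ?L = "measure lebesgue A * measure lebesgue (A + B\<^sub>1 + B\<^sub>2)"
  let ?R = "\<lambda>\<eta>. (measure lebesgue (A + B\<^sub>1) + \<eta>) * (measure lebesgue (A + B\<^sub>2) + \<eta>)"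
  \<comment> \<open>The inequality is proved with slack \<eta> in the factors on the right, and
    \<eta> then tends to 0.\<close>
  have bound: "?L \<le> ?R \<eta>" if \<eta>: "0 < \<eta>" for \<eta>
  proof -
    obtain e1 where e1: "0 < e1" "\<And>S. compact S \<Longrightarrow> S \<subseteq> (A + B\<^sub>1) + cball 0 e1 \<Longrightarrow>
        measure lebesgue S \<le> measure lebesgue (A + B\<^sub>1) + \<eta>"
      using measure_upper_semicontinuous[OF compact_set_plus[OF cA cB1] \<eta>] by blast
    obtain e2 where e2: "0 < e2" "\<And>S. compact S \<Longrightarrow> S \<subseteq> (A + B\<^sub>2) + cball 0 e2 \<Longrightarrow>
        measure lebesgue S \<le> measure lebesgue (A + B\<^sub>2) + \<eta>"
      using measure_upper_semicontinuous[OF compact_set_plus[OF cA cB2] \<eta>] by blast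
    \<comment> \<open>The errors of the two summands of \<open>A + B\<^sub>1\<close> and of
      \<open>A + B\<^sub>2\<close> add up, hence the half.\<close>
    define e where "e = min e1 e2 / 2"
    have e: "0 < e" "e + e \<le> e1" "e + e \<le> e2" using e1(1) e2(1) by (auto simp: e_def)
    obtain p us where A: "A \<subseteq> {p} + zonotope_of us" "{p} + zonotope_of us \<subseteq> A + cball 0 e"
      by (rule zonoid_outer_approximation[OF assms(1) e(1)])
    obtain q ss where B1: "B\<^sub>1 \<subseteq> {q} + zonotope_of ss" "{q} + zonotope_of ss \<subseteq> B\<^sub>1 + cball 0 e"
      by (rule zonoid_outer_approximation[OF assms(2) e(1)])
    obtain r ts where B2: "B\<^sub>2 \<subseteq> {r} + zonotope_of ts" "{r} + zonotope_of ts \<subseteq> B\<^sub>2 + cball 0 e"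
      by (rule zonoid_outer_approximation[OF assms(3) e(1)])
    let ?A = "{p} + zonotope_of us" and ?B1 = "{q} + zonotope_of ss" and ?B2 = "{r} + zonotope_of ts"
    note c = compact_translate_zonotope_of compact_set_plus
    \<comment> \<open>Passing to the outer zonotopes can only enlarge the left side.\<close>
    have "?L \<le> measure lebesgue ?A * measure lebesgue (?A + ?B1 + ?B2)"
    proof (intro mult_mono measure_lebesgue_mono_compact)
      show "A + B\<^sub>1 + B\<^sub>2 \<subseteq> ?A + ?B1 + ?B2"
        using A B1 B2 by (intro set_plus_mono2)
    qed (use A cA cB1 cB2 in \<open>auto intro: c\<close>)
    also have "\<dots> = measure lborel (zonotope_of us) * measure lborel (zonotope_of (ts @ ss @ us))"
      by (simp only: translate_zonotope_of_plus measure_translate_zonotope_of append_assoc)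
    also have "\<dots> \<le> measure lborel (zonotope_of (ts @ us)) * measure lborel (zonotope_of (ss @ us))"
      by (rule volume_zonotope_of_submodular)
    also have "\<dots> = measure lebesgue (?A + ?B1) * measure lebesgue (?A + ?B2)"
      by (simp only: mult.commute translate_zonotope_of_plus measure_translate_zonotope_of)
    \<comment> \<open>Conversely, the sums of the outer zonotopes stay within \<open>e1\<close> of
      \<open>A + B\<^sub>1\<close> and \<open>e2\<close> of \<open>A + B\<^sub>2\<close>, so
      semicontinuity bounds their volumes.\<close>
    also have "\<dots> \<le> ?R \<eta>"
    proof (intro mult_mono e1(2) e2(2))
      show "?A + ?B1 \<subseteq> A + B\<^sub>1 + cball 0 e1" "?A + ?B2 \<subseteq> A + B\<^sub>2 + cball 0 e2"
        by (rule plus_cball_plus_cball_subset[OF A(2) B1(2) e(2)],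
            rule plus_cball_plus_cball_subset[OF A(2) B2(2) e(3)])
    qed (use \<eta> in \<open>auto intro: c\<close>)
    finally show ?thesis .
  qed
  have "(?R \<longlongrightarrow> ?R 0) (at_right 0)" by (intro tendsto_intros)
  then have "?L \<le> ?R 0"
    by (rule tendsto_lowerbound) (auto intro: bound eventually_mono[OF eventually_at_right_less])
  then show ?thesis by simp
qed

end
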